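(* There exists $\varepsilon>0$ such that, setting $$\rho_\varepsilon=\frac{1}{12\varepsilon}\,1_{[1,1+12\varepsilon]}\,dr,$$ a probability measure on $\mathbb{R}_+=(0,\infty)$, the $DDI$-map $T$ associated to $\rho_\varepsilon$ is not $c$-monotone (i.e. the support of the plan $(\mathrm{Id},T,T^{(2)})_\sharp\rho_\varepsilon$ is not a $c$-monotone set) and, therefore, $T$ is not optimal in the cyclical Monge problem $$\inf\Big\{\int_{\mathbb{R}_+}c\big(x,S(x),S^{(2)}(x)\big)\,d\rho_\varepsilon(x)\;:\;S:\mathbb{R}_+\to\mathbb{R}_+\text{ Borel},\ S_\sharp\rho_\varepsilon=\rho_\varepsilon,\ S^{(3)}=\mathrm{Id}\Big\}.$$
   Context: Notation: $\mathbb{R}_+=(0,\infty)$; $S^{(k)}$ is the $k$-fold composition of $S$ with itself; $S_\sharp\rho$ is the push-forward measure. Maps, and the identity $S^{(3)}=\mathrm{Id}$, are understood up to $\rho$-negligible sets. A map is optimal in the Monge problem if it is admissible and attains the infimum. Cost. For $r_1,r_2,r_3\in\mathbb{R}_+$, $$c(r_1,r_2,r_3)=\min\Big\{\frac1{|v_2-v_1|}+\frac1{|v_3-v_2|}+\frac1{|v_1-v_3|}\;:\;v_i\in\mathbb{R}^2,\ |v_i|=r_i,\ i=1,2,3\Big\}.$$ $DDI$-map. Let $\rho$ be a non-atomic probability measure on $\mathbb{R}_+$ and let $d_1,d_2\in\mathbb{R}_+$ be such that $\rho((0,d_1])=\rho([d_1,d_2])=\rho([d_2,\infty))=1/3$.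 The $DDI$-map associated to $\rho$ is the unique (up to $\rho$-negligible sets) map $T:\mathbb{R}_+\to\mathbb{R}_+$ such that $T_\sharp\rho=\rho$ and $T$ maps $(0,d_1)$ onto $(d_1,d_2)$ decreasingly, $(d_1,d_2)$ onto $(d_2,\infty)$ decreasingly, and $(d_2,\infty)$ onto $(0,d_1)$ increasingly (that is, on each of the three intervals $T$ is the monotone map, with the indicated monotonicity, pushing the restriction of $\rho$ to that interval forward to the restriction of $\rho$ to the target interval). $c$-monotonicity. For $x,y\in(\mathbb{R}_+)^3$ and $p\subseteq\{1,2,3\}$, let $X(x,y,p),Y(x,y,p)\in(\mathbb{R}_+)^3$ be given by $X_i=x_i,\ Y_i=y_i$ if $i\in p$ and $X_i=y_i,\ Y_i=x_i$ if $i\notin p$. A set $\Gamma\subset(\mathbb{R}_+)^3$ is $c$-monotone if $c(x)+c(y)\le c(X(x,y,p))+c(Y(x,y,p))$ for all $x,y\in\Gamma$ and all $p\subseteq\{1,2,3\}$. *)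

theory Defs
  imports "HOL-Probability.Probability"
begin

text \<open>
  Throughout, a measure on $(0,\infty)$ is a measure \<open>\<rho>\<close> of type \<open>real measure\<close> whose space is
  \<open>{0<..}\<close> with the Borel sets of \<open>{0<..}\<close>. Hence \<open>S \<in> \<rho> \<rightarrow>\<^sub>M \<rho>\<close> says that \<open>S\<close> is a Borel map
  from $(0,\infty)$ to itself (its values outside \<open>{0<..}\<close> are irrelevant).
\<close>

definition nonatomic_prob :: "real measure \<Rightarrow> bool" where
  "nonatomic_prob \<rho> \<longleftrightarrow>
     sets \<rho> = sets (restrict_space borel {0<..}) \<and> prob_space \<rho> \<and>
     (\<forall>x>0. emeasure \<rho> {x} = 0)"

text \<open>
  The cost takes values in \<open>ennreal\<close>, where \<open>1 / 0 = \<infinity>\<close>, so configurations with coinciding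
  points have infinite energy. (In \<open>real\<close> one would have \<open>1 / 0 = 0\<close>.)
  For positive radii the infimum is a minimum.
\<close>

definition coulomb :: "real^2 \<Rightarrow> real^2 \<Rightarrow> real^2 \<Rightarrow> ennreal" where
  "coulomb v1 v2 v3 =
     1 / ennreal (norm (v2 - v1)) + 1 / ennreal (norm (v3 - v2)) + 1 / ennreal (norm (v1 - v3))"

definition cost :: "real \<Rightarrow> real \<Rightarrow> real \<Rightarrow> ennreal" where
  "cost r1 r2 r3 =
     Inf {coulomb v1 v2 v3 | v1 v2 v3. norm v1 = r1 \<and> norm v2 = r2 \<and> norm v3 = r3}"

definition cost_vec :: "real^3 \<Rightarrow> ennreal" where
  "cost_vec x = cost (x $ 1) (x $ 2) (x $ 3)"

text \<open>
  The restriction of \<open>\<rho>\<close> to \<open>I\<close> is \<open>density \<rho> (indicator I)\<close>. Monotonicity of \<open>T\<close> on \<open>I\<close> is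
  required off a \<open>\<rho>\<close>-null set, since maps are understood up to null sets.
\<close>

definition monotone_transport ::
    "(real \<Rightarrow> real \<Rightarrow> bool) \<Rightarrow> real measure \<Rightarrow> (real \<Rightarrow> real) \<Rightarrow> real set \<Rightarrow> real set \<Rightarrow> bool" where
  "monotone_transport ord \<rho> T I J \<longleftrightarrow>
     (\<exists>N\<in>null_sets \<rho>. monotone_on (I - N) (\<le>) ord T) \<and>
     distr (density \<rho> (indicator I)) \<rho> T = density \<rho> (indicator J)"

abbreviation increasing_transport ::
    "real measure \<Rightarrow> (real \<Rightarrow> real) \<Rightarrow> real set \<Rightarrow> real set \<Rightarrow> bool" where
  "increasing_transport \<equiv> monotone_transport (\<le>)"

abbreviation decreasing_transport ::
    "real measure \<Rightarrow> (real \<Rightarrow> real) \<Rightarrow> real set \<Rightarrow> real set \<Rightarrow> bool" where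
  "decreasing_transport \<equiv> monotone_transport (\<ge>)"

definition DDI_map :: "real measure \<Rightarrow> (real \<Rightarrow> real) \<Rightarrow> bool" where
  "DDI_map \<rho> T \<longleftrightarrow>
     nonatomic_prob \<rho> \<and>
     T \<in> \<rho> \<rightarrow>\<^sub>M \<rho> \<and> distr \<rho> \<rho> T = \<rho> \<and>
     (\<exists>d1>0. \<exists>d2>0.
        measure \<rho> {0<..d1} = 1/3 \<and> measure \<rho> {d1..d2} = 1/3 \<and> measure \<rho> {d2..} = 1/3 \<and>
        decreasing_transport \<rho> T {0<..<d1} {d1<..<d2} \<and>
        decreasing_transport \<rho> T {d1<..<d2} {d2<..} \<and>
        increasing_transport \<rho> T {d2<..} {0<..<d1})"

definition swap_X :: "real^3 \<Rightarrow> real^3 \<Rightarrow> 3 set \<Rightarrow> real^3" where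
  "swap_X x y p = (\<chi> i. if i \<in> p then x $ i else y $ i)"

definition swap_Y :: "real^3 \<Rightarrow> real^3 \<Rightarrow> 3 set \<Rightarrow> real^3" where
  "swap_Y x y p = (\<chi> i. if i \<in> p then y $ i else x $ i)"

definition c_monotone :: "(real^3) set \<Rightarrow> bool" where
  "c_monotone \<Gamma> \<longleftrightarrow>
     (\<forall>x\<in>\<Gamma>. \<forall>y\<in>\<Gamma>. \<forall>p.
        cost_vec x + cost_vec y \<le> cost_vec (swap_X x y p) + cost_vec (swap_Y x y p))"

definition cyclic_plan :: "real measure \<Rightarrow> (real \<Rightarrow> real) \<Rightarrow> (real^3) measure" where
  "cyclic_plan \<rho> T = distr \<rho> borel (\<lambda>x. vector [x, T x, (T ^^ 2) x])"

text \<open>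
  The support is taken in the ambient space $(0,\infty)^3$, i.e. it is the topological support
  in $\mathbb{R}^3$ intersected with the open positive octant.
\<close>

definition plan_support :: "(real^3) measure \<Rightarrow> (real^3) set" where
  "plan_support \<mu> =
     {x. (\<forall>i. 0 < x $ i) \<and> (\<forall>U. open U \<and> x \<in> U \<longrightarrow> 0 < emeasure \<mu> U)}"

definition cyclic_admissible :: "real measure \<Rightarrow> (real \<Rightarrow> real) set" where
  "cyclic_admissible \<rho> =
     {S. S \<in> \<rho> \<rightarrow>\<^sub>M \<rho> \<and> distr \<rho> \<rho> S = \<rho> \<and> (AE x in \<rho>. (S ^^ 3) x = x)}"

definition monge_cost :: "real measure \<Rightarrow> (real \<Rightarrow> real) \<Rightarrow> ennreal" where
  "monge_cost \<rho> S = (\<integral>\<^sup>+ x. cost x (S x) ((S ^^ 2) x) \<partial>\<rho>)"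

definition monge_optimal :: "real measure \<Rightarrow> (real \<Rightarrow> real) \<Rightarrow> bool" where
  "monge_optimal \<rho> T \<longleftrightarrow>
     T \<in> cyclic_admissible \<rho> \<and>
     monge_cost \<rho> T = (INF S\<in>cyclic_admissible \<rho>. monge_cost \<rho> S)"

definition rho_eps :: "real \<Rightarrow> real measure" where
  "rho_eps \<epsilon> =
     density (restrict_space lborel {0<..})
       (\<lambda>r. ennreal (1 / (12 * \<epsilon>) * indicator {1..1 + 12 * \<epsilon>} r))"

end

theory Submission
  imports Defs
begin

text \<open>
  Take \<open>\<epsilon> = 1/4\<close>, so that \<open>\<rho>\<close> is uniform on \<open>[1, 4]\<close> and the orbits of the \<open>DDI\<close>-map are
  \<open>(t, 4 - t, t + 2)\<close> with \<open>1 < t < 2\<close>. Near the ends \<open>t = 1\<close> and \<open>t = 2\<close>, exchanging the largest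
  radii of two orbits replaces the triples \<open>(1, 3, 3)\<close>, \<open>(2, 2, 4)\<close> by \<open>(1, 3, 4)\<close>, \<open>(2, 2, 3)\<close>,
  which lowers the total cost by about \<open>0.005\<close>. Conjugating the \<open>DDI\<close>-map by the involution that
  exchanges short intervals at the two ends of \<open>(3, 4)\<close> gives a cyclical competitor that is
  strictly cheaper.

  The cost is estimated from above by explicit configurations and from below by duality. The tangent
  bound \<open>1/d \<ge> 3p - 4p\<^sup>3d\<^sup>2\<close>, with \<open>p\<close> of the form \<open>b\<^sub>ib\<^sub>j\<close>, reduces the lower bound to a weighted
  sum of squared distances, which is controlled by \<open>0 \<le> |\<Sum> b\<^sub>i\<^sup>3 v\<^sub>i|\<^sup>2\<close>. The bound is sharp at a
  non-collinear critical configuration, where \<open>b\<^sub>ib\<^sub>j = 1/(2|v\<^sub>i - v\<^sub>j|)\<close>.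
\<close>

section \<open>Estimates for the cost\<close>

text \<open>With x = p d the claim is 1 - 3x + 4x^3 = (1 - 2x)^2 (1 + x) >= 0. The left side is the
  tangent of 1/d, as a convex function of d^2, at d = 1/(2p). At d = 0 the right side is
  infinite.\<close>

lemma inverse_ge_cubic:
  fixes p d :: real
  assumes "0 < p" "0 \<le> d"
  shows "ennreal (3 * p - 4 * p ^ 3 * d\<^sup>2) \<le> 1 / ennreal d"
proof (cases "d = 0")
  case True
  then show ?thesis by (simp add: ennreal_divide_eq_top_iff top_unique)
next
  case False
  with assms have d: "0 < d" by simp
  have "0 \<le> (1 - 2 * (p * d))\<^sup>2 * (1 + p * d)"
    using assms by simp
  also have "\<dots> = 1 - (3 * p - 4 * p ^ 3 * d\<^sup>2) * d"
    by (simp add: power2_eq_square power3_eq_cube algebra_simps)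
  finally have "3 * p - 4 * p ^ 3 * d\<^sup>2 \<le> 1 / d"
    using d by (simp add: field_simps)
  then have "ennreal (3 * p - 4 * p ^ 3 * d\<^sup>2) \<le> ennreal (1 / d)"
    by (rule ennreal_leI)
  also have "\<dots> = 1 / ennreal d"
    using divide_ennreal[of 1 d] d by simp
  finally show ?thesis .
qed

lemma ennreal_add_le: "ennreal (a + b) \<le> ennreal a + ennreal b"
  by (smt (verit) add.right_neutral add_0 ennreal_leI ennreal_neg ennreal_plus order_refl le_add_same_cancel1 zero_le)

text \<open>Lagrange's identity: the two sides differ by the squared norm of the weighted sum, so
  equality means that this sum vanishes.\<close>

lemma weighted_distances_le:
  fixes v1 v2 v3 :: "'a :: real_inner"
  shows "a * b * (norm (v2 - v1))\<^sup>2 + b * c * (norm (v3 - v2))\<^sup>2 + c * a * (norm (v1 - v3))\<^sup>2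
    \<le> (a + b + c) * (a * (norm v1)\<^sup>2 + b * (norm v2)\<^sup>2 + c * (norm v3)\<^sup>2)"
proof -
  have "0 \<le> (norm (a *\<^sub>R v1 + b *\<^sub>R v2 + c *\<^sub>R v3))\<^sup>2" by simp
  also have "\<dots> = (a + b + c) * (a * (norm v1)\<^sup>2 + b * (norm v2)\<^sup>2 + c * (norm v3)\<^sup>2)
    - (a * b * (norm (v2 - v1))\<^sup>2 + b * c * (norm (v3 - v2))\<^sup>2 + c * a * (norm (v1 - v3))\<^sup>2)"
    by (simp add: power2_norm_eq_inner inner_add_left inner_add_right inner_diff_left
        inner_diff_right inner_commute algebra_simps)
  finally show ?thesis by simp
qed

text \<open>The tangent bound is applied to each pair with p = \<open>b_i * b_j\<close>. Then p^3 is
  a product of vertex weights \<open>b_i ^ 3\<close>, and the squared distances enter exactly as in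
  \<open>weighted_distances_le\<close>. The resulting bound decreases as the radii grow, so one
  choice of weights serves all radii up to the \<open>s_i\<close>.\<close>

lemma cost_ge:
  assumes b: "0 < b1" "0 < b2" "0 < b3"
    and s: "\<bar>r1\<bar> \<le> s1" "\<bar>r2\<bar> \<le> s2" "\<bar>r3\<bar> \<le> s3"
  shows "ennreal (3 * (b1 * b2 + b2 * b3 + b3 * b1)
      - 4 * ((b1 ^ 3 + b2 ^ 3 + b3 ^ 3) * (b1 ^ 3 * s1\<^sup>2 + b2 ^ 3 * s2\<^sup>2 + b3 ^ 3 * s3\<^sup>2)))
    \<le> cost r1 r2 r3"
  unfolding cost_def
proof (rule Inf_greatest, safe)
  fix v1 v2 v3 :: "real^2"
  assume r: "r1 = norm v1" "r2 = norm v2" "r3 = norm v3"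
  let ?D = "b1 ^ 3 * b2 ^ 3 * (norm (v2 - v1))\<^sup>2 + b2 ^ 3 * b3 ^ 3 * (norm (v3 - v2))\<^sup>2
    + b3 ^ 3 * b1 ^ 3 * (norm (v1 - v3))\<^sup>2"
  let ?e = "\<lambda>p d :: real. 3 * p - 4 * p ^ 3 * d\<^sup>2"
  have "?D \<le> (b1 ^ 3 + b2 ^ 3 + b3 ^ 3)
      * (b1 ^ 3 * (norm v1)\<^sup>2 + b2 ^ 3 * (norm v2)\<^sup>2 + b3 ^ 3 * (norm v3)\<^sup>2)"
    by (rule weighted_distances_le)
  also have "\<dots> \<le> (b1 ^ 3 + b2 ^ 3 + b3 ^ 3)
      * (b1 ^ 3 * s1\<^sup>2 + b2 ^ 3 * s2\<^sup>2 + b3 ^ 3 * s3\<^sup>2)"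
    using b s unfolding r by (intro mult_left_mono add_mono power_mono) auto
  finally have D: "?D \<le> (b1 ^ 3 + b2 ^ 3 + b3 ^ 3)
      * (b1 ^ 3 * s1\<^sup>2 + b2 ^ 3 * s2\<^sup>2 + b3 ^ 3 * s3\<^sup>2)" .
  have "ennreal (3 * (b1 * b2 + b2 * b3 + b3 * b1)
      - 4 * ((b1 ^ 3 + b2 ^ 3 + b3 ^ 3) * (b1 ^ 3 * s1\<^sup>2 + b2 ^ 3 * s2\<^sup>2 + b3 ^ 3 * s3\<^sup>2)))
    \<le> ennreal (3 * (b1 * b2 + b2 * b3 + b3 * b1) - 4 * ?D)"
    using D by (intro ennreal_leI diff_left_mono mult_left_mono) auto
  also have "3 * (b1 * b2 + b2 * b3 + b3 * b1) - 4 * ?D =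
      ?e (b1 * b2) (norm (v2 - v1)) + ?e (b2 * b3) (norm (v3 - v2)) + ?e (b3 * b1) (norm (v1 - v3))"
    by (simp add: power_mult_distrib algebra_simps)
  \<comment> \<open>Single summands may be negative and are then truncated to 0 by
    \<open>ennreal\<close>, hence only an inequality.\<close>
  also have "ennreal \<dots> \<le> ennreal (?e (b1 * b2) (norm (v2 - v1)))
      + ennreal (?e (b2 * b3) (norm (v3 - v2))) + ennreal (?e (b3 * b1) (norm (v1 - v3)))"
    by (meson add_mono ennreal_add_le order_refl order_trans)
  also have "\<dots> \<le> coulomb v1 v2 v3"
    unfolding coulomb_def using b by (intro add_mono inverse_ge_cubic) auto
  finally show "ennreal (3 * (b1 * b2 + b2 * b3 + b3 * b1)
      - 4 * ((b1 ^ 3 + b2 ^ 3 + b3 ^ 3) * (b1 ^ 3 * s1\<^sup>2 + b2 ^ 3 * s2\<^sup>2 + b3 ^ 3 * s3\<^sup>2)))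
    \<le> coulomb v1 v2 v3" .
qed

text \<open>Law of cosines: if the angle is not acute, the distance grows with both radii, so lower
  bounds for the radii suffice. The bound \<open>d\<close> enters through its square, which keeps
  square roots out of numerical checks.\<close>

lemma distance_ge_of_obtuse:
  fixes u v :: "'a :: real_inner"
  assumes u: "norm u = 1" "norm v = 1" "u \<bullet> v \<le> 0"
    and s: "0 \<le> s" "s \<le> r" "0 \<le> s'" "s' \<le> r'"
    and d: "d\<^sup>2 \<le> s\<^sup>2 + s'\<^sup>2 - 2 * s * s' * (u \<bullet> v)"
  shows "d \<le> norm (r' *\<^sub>R v - r *\<^sub>R u)"
proof (rule power2_le_imp_le)
  have *: "(norm (r' *\<^sub>R v - r *\<^sub>R u))\<^sup>2 = r\<^sup>2 + r'\<^sup>2 + 2 * (r * r') * (- (u \<bullet> v))"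
    unfolding power2_norm_eq_inner using u
    by (simp add: inner_diff_left inner_diff_right inner_commute power2_eq_square
        algebra_simps norm_eq_1)
  have "d\<^sup>2 \<le> s\<^sup>2 + s'\<^sup>2 + 2 * (s * s') * (- (u \<bullet> v))"
    using d by simp
  also have "\<dots> \<le> r\<^sup>2 + r'\<^sup>2 + 2 * (r * r') * (- (u \<bullet> v))"
    using s u by (intro add_mono power_mono mult_right_mono mult_left_mono mult_mono) auto
  finally show "d\<^sup>2 \<le> (norm (r' *\<^sub>R v - r *\<^sub>R u))\<^sup>2" using * by simp
qed simp

lemma one_divide_ennreal_le:
  fixes d x :: real
  assumes "0 < d" "d \<le> x"
  shows "1 / ennreal x \<le> ennreal (1 / d)"
proof -
  have "1 / ennreal x = ennreal (1 / x)"
    using assms divide_ennreal[of 1 x] by simp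
  also have "\<dots> \<le> ennreal (1 / d)"
    using assms by (intro ennreal_leI) (simp add: frac_le)
  finally show ?thesis .
qed

text \<open>The directions stay fixed while the radii vary: with pairwise non-acute angles, one
  configuration bounds the cost for all radii above the \<open>s_i\<close>.\<close>

lemma cost_le:
  fixes u1 u2 u3 :: "real^2"
  assumes u: "norm u1 = 1" "norm u2 = 1" "norm u3 = 1"
      "u1 \<bullet> u2 \<le> 0" "u2 \<bullet> u3 \<le> 0" "u3 \<bullet> u1 \<le> 0"
    and s: "0 \<le> s1" "s1 \<le> r1" "0 \<le> s2" "s2 \<le> r2" "0 \<le> s3" "s3 \<le> r3"
    and d: "0 < d1" "0 < d2" "0 < d3"
      "d1\<^sup>2 \<le> s1\<^sup>2 + s2\<^sup>2 - 2 * s1 * s2 * (u1 \<bullet> u2)"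
      "d2\<^sup>2 \<le> s2\<^sup>2 + s3\<^sup>2 - 2 * s2 * s3 * (u2 \<bullet> u3)"
      "d3\<^sup>2 \<le> s3\<^sup>2 + s1\<^sup>2 - 2 * s3 * s1 * (u3 \<bullet> u1)"
  shows "cost r1 r2 r3 \<le> ennreal (1 / d1 + 1 / d2 + 1 / d3)"
proof -
  have "cost r1 r2 r3 \<le> coulomb (r1 *\<^sub>R u1) (r2 *\<^sub>R u2) (r3 *\<^sub>R u3)"
    unfolding cost_def using u s
    by (intro Inf_lower CollectI exI[of _ "r1 *\<^sub>R u1"] exI[of _ "r2 *\<^sub>R u2"] exI[of _ "r3 *\<^sub>R u3"])
      auto
  also have "\<dots> \<le> ennreal (1 / d1) + ennreal (1 / d2) + ennreal (1 / d3)"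
    unfolding coulomb_def using assms
    by (intro add_mono one_divide_ennreal_le distance_ge_of_obtuse) auto
  also have "\<dots> = ennreal (1 / d1 + 1 / d2 + 1 / d3)"
    using d by (simp add: ennreal_plus)
  finally show ?thesis .
qed

text \<open>The energy is invariant under cyclic relabelling. This makes the integrand of
  \<open>monge_cost\<close> constant along the orbits of a map of order three.\<close>

lemma cost_rotate: "cost a b c = cost b c a"
proof -
  have "cost b c a \<le> cost a b c" for a b c
    unfolding cost_def
  proof (rule Inf_mono, safe)
    fix v1 v2 v3 :: "real^2"
    have "coulomb v2 v3 v1 = coulomb v1 v2 v3"
      by (simp add: coulomb_def add_ac)
    then show "\<exists>k\<in>{coulomb w1 w2 w3 |w1 w2 w3. norm w1 = norm v2 \<and> norm w2 = norm v3 \<and> norm w3 = norm v1}.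
        k \<le> coulomb v1 v2 v3"
      by (intro bexI[of _ "coulomb v2 v3 v1"] CollectI exI[of _ v2] exI[of _ v3] exI[of _ v1]) auto
  qed
  from this[of a b c] this[of b c a] this[of c a b] show ?thesis by simp
qed

lemma inner_vector_2: "(vector [a, b] :: real^2) \<bullet> vector [c, d] = a * c + b * d"
  by (simp add: inner_vec_def sum_2)

text \<open>
  The weights \<open>b\<^sub>i\<close> and the unit vectors below are rational roundings of those of the numerically
  computed optimal configurations.
\<close>

lemma cost_ge_1_3_3:
  assumes "\<bar>r1\<bar> \<le> 1.001" "\<bar>r2\<bar> \<le> 3" "\<bar>r3\<bar> \<le> 3.001"
  shows "ennreal 0.7469 \<le> cost r1 r2 r3"
  by (rule order_trans[OF _ cost_ge[of "447 / 1000" "31 / 100" "31 / 100", OF _ _ _ assms]])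
    ((rule ennreal_leI)?, simp add: power2_eq_square power3_eq_cube)+

lemma cost_ge_2_2_4:
  assumes "\<bar>r1\<bar> \<le> 2" "\<bar>r2\<bar> \<le> 2.001" "\<bar>r3\<bar> \<le> 4"
  shows "ennreal 0.6618 \<le> cost r1 r2 r3"
  by (rule order_trans[OF _ cost_ge[of "368 / 1000" "368 / 1000" "266 / 1000", OF _ _ _ assms]])
    ((rule ennreal_leI)?, simp add: power2_eq_square power3_eq_cube)+

lemma cost_le_1_3_4:
  assumes "1 \<le> r1" "2.999 \<le> r2" "3.999 \<le> r3"
  shows "cost r1 r2 r3 \<le> ennreal 0.6584"
proof -
  \<comment> \<open>The coordinates come from Pythagorean triples, so the vectors have norm exactly
    1. The denominators in the next bound are distances rounded down.\<close>
  let ?u1 = "vector [1, 0] :: real^2" and ?u2 = "vector [- 133 / 205, 156 / 205] :: real^2"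
    and ?u3 = "vector [- 57 / 185, - 176 / 185] :: real^2"
  have "cost r1 r2 r3 \<le> ennreal (1 / 3.726 + 1 / 6.128 + 1 / 4.41)"
    using assms by (intro cost_le[of ?u1 ?u2 ?u3 1 _ "2.999" _ "3.999"])
      (simp_all add: norm_eq_1 inner_vector_2 power2_eq_square)
  also have "\<dots> \<le> ennreal 0.6584"
    by (intro ennreal_leI) simp
  finally show ?thesis .
qed

lemma cost_le_2_2_3:
  assumes "1.999 \<le> r1" "2 \<le> r2" "3 \<le> r3"
  shows "cost r1 r2 r3 \<le> ennreal 0.7464"
proof -
  let ?u1 = "vector [1, 0] :: real^2" and ?u2 = "vector [- 3 / 5, 4 / 5] :: real^2"
    and ?u3 = "vector [- 39 / 89, - 80 / 89] :: real^2"
  have "cost r1 r2 r3 \<le> ennreal (1 / 3.576 + 1 / 4.298 + 1 / 4.272)"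
    using assms by (intro cost_le[of ?u1 ?u2 ?u3 "1.999" _ 2 _ 3])
      (simp_all add: norm_eq_1 inner_vector_2 power2_eq_square)
  also have "\<dots> \<le> ennreal 0.7464"
    by (intro ennreal_leI) simp
  finally show ?thesis .
qed

text \<open>A crude bound, which makes the integral over the unaffected orbits finite, so that it
  can be cancelled in a strict inequality.\<close>

lemma cost_le_3:
  assumes "1 \<le> r1" "1 \<le> r2" "1 \<le> r3"
  shows "cost r1 r2 r3 \<le> ennreal 3"
proof -
  let ?u1 = "vector [1, 0] :: real^2" and ?u2 = "vector [- 3 / 5, 4 / 5] :: real^2"
    and ?u3 = "vector [- 3 / 5, - 4 / 5] :: real^2"
  have "cost r1 r2 r3 \<le> ennreal (1 / 1 + 1 / 1 + 1 / 1)"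
    using assms by (intro cost_le[of ?u1 ?u2 ?u3 1 _ 1 _ 1])
      (simp_all add: norm_eq_1 inner_vector_2 power2_eq_square)
  then show ?thesis by simp
qed

text \<open>In \<open>cost\<close> the set of competitors varies with the radii. Here the infimum
  runs over a fixed set of directions and the radii enter only the energy, which gives Borel
  measurability.\<close>

definition polar_cost :: "real \<times> real \<times> real \<Rightarrow> ennreal" where
  "polar_cost r = (INF u\<in>{u :: (real^2) \<times> (real^2) \<times> (real^2).
      norm (fst u) = 1 \<and> norm (fst (snd u)) = 1 \<and> norm (snd (snd u)) = 1}.
    coulomb (fst r *\<^sub>R fst u) (fst (snd r) *\<^sub>R fst (snd u)) (snd (snd r) *\<^sub>R snd (snd u)))"

text \<open>Positive radii force each point to be nonzero, so \<open>sgn\<close> supplies a unit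
  direction.\<close>

lemma cost_eq_polar_cost:
  assumes "0 < r1" "0 < r2" "0 < r3"
  shows "cost r1 r2 r3 = polar_cost (r1, r2, r3)"
proof -
  have *: "v = norm v *\<^sub>R sgn v" for v :: "real^2"
    by (cases "v = 0") (simp_all add: sgn_div_norm)
  have "{coulomb v1 v2 v3 | v1 v2 v3. norm v1 = r1 \<and> norm v2 = r2 \<and> norm v3 = r3} =
    (\<lambda>u. coulomb (r1 *\<^sub>R fst u) (r2 *\<^sub>R fst (snd u)) (r3 *\<^sub>R snd (snd u))) `
    {u :: (real^2) \<times> (real^2) \<times> (real^2).
      norm (fst u) = 1 \<and> norm (fst (snd u)) = 1 \<and> norm (snd (snd u)) = 1}" (is "?L = ?R")
  proof
    show "?L \<subseteq> ?R"
    proof safe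
      fix v1 v2 v3 :: "real^2"
      assume r: "r1 = norm v1" "r2 = norm v2" "r3 = norm v3"
      then show "coulomb v1 v2 v3 \<in> (\<lambda>u. coulomb (norm v1 *\<^sub>R fst u) (norm v2 *\<^sub>R fst (snd u))
          (norm v3 *\<^sub>R snd (snd u))) ` {u :: (real^2) \<times> (real^2) \<times> (real^2).
        norm (fst u) = 1 \<and> norm (fst (snd u)) = 1 \<and> norm (snd (snd u)) = 1}"
        using assms *[of v1] *[of v2] *[of v3]
        by (intro image_eqI[of _ _ "(sgn v1, sgn v2, sgn v3)"]) (auto simp: norm_sgn)
    qed
    show "?R \<subseteq> ?L"
      proof safe
      fix u1 u2 u3 :: "real^2"
      assume "norm (fst (u1, u2, u3)) = 1" "norm (fst (snd (u1, u2, u3))) = 1"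
        "norm (snd (snd (u1, u2, u3))) = 1"
      with assms show "\<exists>v1 v2 v3. coulomb (r1 *\<^sub>R fst (u1, u2, u3)) (r2 *\<^sub>R fst (snd (u1, u2, u3)))
          (r3 *\<^sub>R snd (snd (u1, u2, u3))) = coulomb v1 v2 v3
          \<and> norm v1 = r1 \<and> norm v2 = r2 \<and> norm v3 = r3"
        by (intro exI[of _ "r1 *\<^sub>R u1"] exI[of _ "r2 *\<^sub>R u2"] exI[of _ "r3 *\<^sub>R u3"]) auto
    qed
  qed
  then show ?thesis
    unfolding cost_def polar_cost_def by simp
qed

text \<open>An infimum of continuous functions is upper semicontinuous.\<close>

lemma borel_measurable_polar_cost [measurable]: "polar_cost \<in> borel_measurable borel"
proof (rule borel_measurableI_less)
  fix y
  let ?U = "{u :: (real^2) \<times> (real^2) \<times> (real^2).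
      norm (fst u) = 1 \<and> norm (fst (snd u)) = 1 \<and> norm (snd (snd u)) = 1}"
  let ?c = "\<lambda>r u. coulomb (fst r *\<^sub>R fst u) (fst (snd r) *\<^sub>R fst (snd u)) (snd (snd r) *\<^sub>R snd (snd u))"
  \<comment> \<open>Inversion on \<open>ennreal\<close> is continuous also at 0, so collisions need
    no separate treatment.\<close>
  have "open {r. ?c r u < y}" for u
    unfolding coulomb_def divide_ennreal_def mult_1_left
    by (intro open_Collect_less continuous_on_add continuous_on_inverse_ennreal
        continuous_on_ennreal continuous_on_norm continuous_on_const) (intro continuous_intros)+
  then have "open (\<Union>u\<in>?U. {r. ?c r u < y})"
    by blast
  also have "(\<Union>u\<in>?U. {r. ?c r u < y}) = {r \<in> space borel. polar_cost r < y}"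
    unfolding polar_cost_def by (simp add: INF_less_iff set_eq_iff)
  finally show "{r \<in> space borel. polar_cost r < y} \<in> sets borel"
    by simp
qed

section \<open>The uniform measure on $[1,4]$\<close>

abbreviation \<rho> :: "real measure" where "\<rho> \<equiv> rho_eps (1 / 4)"

lemma sets_rho: "sets \<rho> = sets (restrict_space borel {0<..})"
  by (auto simp: rho_eps_def sets_restrict_space)

lemma space_rho [simp]: "space \<rho> = {0<..}"
  by (simp add: rho_eps_def space_restrict_space)

lemma sets_rho_iff: "A \<in> sets \<rho> \<longleftrightarrow> A \<subseteq> {0<..} \<and> A \<in> sets borel"
  unfolding sets_rho by (subst sets_restrict_space_iff) auto

text \<open>The null endpoints are dropped to match the open intervals on which the maps below are
  affine.\<close>

lemma nn_integral_rho:
  assumes [measurable]: "g \<in> borel_measurable borel"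
  shows "(\<integral>\<^sup>+x. g x \<partial>\<rho>) = ennreal (1 / 3) * (\<integral>\<^sup>+x\<in>{1<..<4}. g x \<partial>lborel)"
proof -
  have \<rho>: "\<rho> = density (restrict_space lborel {0<..}) (\<lambda>r. ennreal (1 / 3 * indicator {1..4} r))"
    by (simp add: rho_eps_def)
  have "(\<integral>\<^sup>+x. g x \<partial>\<rho>)
    = (\<integral>\<^sup>+x. ennreal (1 / 3 * indicator {1..4} x) * g x \<partial>restrict_space lborel {0<..})"
    unfolding \<rho> by (intro nn_integral_density measurable_restrict_space1) measurable
  also have "\<dots> = (\<integral>\<^sup>+x. ennreal (1 / 3 * indicator {1..4} x) * g x * indicator {0<..} x \<partial>lborel)"
    by (rule nn_integral_restrict_space) simp
  also have "\<dots> = (\<integral>\<^sup>+x. ennreal (1 / 3) * (g x * indicator {1<..<4} x) \<partial>lborel)"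
    using AE_lborel_singleton[of "1::real"] AE_lborel_singleton[of "4::real"]
    by (intro nn_integral_cong_AE, eventually_elim) (auto split: split_indicator)
  also have "\<dots> = ennreal (1 / 3) * (\<integral>\<^sup>+x\<in>{1<..<4}. g x \<partial>lborel)"
    by (rule nn_integral_cmult) simp
  finally show ?thesis .
qed

lemma emeasure_rho:
  assumes "A \<in> sets borel" "A \<subseteq> {0<..}"
  shows "emeasure \<rho> A = ennreal (1 / 3) * emeasure lborel (A \<inter> {1<..<4})"
proof -
  have "emeasure \<rho> A = (\<integral>\<^sup>+x. indicator A x \<partial>\<rho>)"
    using assms by (subst nn_integral_indicator) (auto simp: sets_rho_iff)
  also have "\<dots> = ennreal (1 / 3) * (\<integral>\<^sup>+x\<in>{1<..<4}. indicator A x \<partial>lborel)"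
    using assms by (intro nn_integral_rho) auto
  also have "(\<integral>\<^sup>+x\<in>{1<..<4}. indicator A x \<partial>lborel) = (\<integral>\<^sup>+x. indicator (A \<inter> {1<..<4}) x \<partial>lborel)"
    by (intro nn_integral_cong) (auto split: split_indicator)
  also have "\<dots> = emeasure lborel (A \<inter> {1<..<4})"
    using assms by (intro nn_integral_indicator) auto
  finally show ?thesis .
qed

lemma prob_space_rho: "prob_space \<rho>"
proof (rule prob_spaceI)
  have "{0<..} \<inter> {1<..<4::real} = {1<..<4}" by auto
  then show "emeasure \<rho> (space \<rho>) = 1"
    using emeasure_rho[of "{0<..}"] by (simp add: ennreal_mult[symmetric] flip: ennreal_numeral ennreal_1)
qed

lemma emeasure_rho_singleton: "0 < x \<Longrightarrow> emeasure \<rho> {x} = 0"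
proof -
  assume "0 < x"
  moreover have "emeasure lborel ({x} \<inter> {1<..<4}) \<le> emeasure lborel {x}"
    by (intro emeasure_mono) auto
  ultimately show ?thesis by (subst emeasure_rho) auto
qed

lemma AE_rho_not_singleton: "0 < c \<Longrightarrow> AE x in \<rho>. x \<noteq> c"
  by (rule AE_I[of _ _ "{c}"]) (auto simp: emeasure_rho_singleton sets_rho_iff)

lemma AE_rho_interior: "AE x in \<rho>. 1 < x \<and> x < 4 \<and> x \<noteq> 2 \<and> x \<noteq> 3"
proof -
  have "AE x in \<rho>. 1 < x \<and> x < 4"
  proof (rule AE_I)
    show "{x \<in> space \<rho>. \<not> (1 < x \<and> x < 4)} \<subseteq> {0<..1} \<union> {4..}" by auto
    show "{0<..1::real} \<union> {4..} \<in> sets \<rho>" by (auto simp: sets_rho_iff)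
    have "({0<..1::real} \<union> {4..}) \<inter> {1<..<4} = {}" by auto
    then show "emeasure \<rho> ({0<..1} \<union> {4..}) = 0"
      by (subst emeasure_rho) auto
  qed
  with AE_rho_not_singleton[of 2, simplified] AE_rho_not_singleton[of 3, simplified] show ?thesis
    by eventually_elim simp
qed

lemma nonatomic_prob_rho: "nonatomic_prob \<rho>"
  by (simp add: nonatomic_prob_def sets_rho prob_space_rho emeasure_rho_singleton)

lemma measurable_rhoI:
  assumes "f \<in> borel_measurable borel" "\<And>x. 0 < x \<Longrightarrow> 0 < f x"
  shows "f \<in> \<rho> \<rightarrow>\<^sub>M \<rho>"
proof -
  have "f \<in> restrict_space borel {0<..} \<rightarrow>\<^sub>M restrict_space borel {0<..}"
    using assms by (intro measurable_restrict_space3) auto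
  then show ?thesis
    using measurable_cong_sets[OF sets_rho sets_rho] by blast
qed

lemma measurable_rho_borel:
  assumes "f \<in> borel_measurable borel"
  shows "f \<in> borel_measurable \<rho>"
  using measurable_restrict_space1[OF assms] measurable_cong_sets[OF sets_rho refl] by blast

section \<open>Splitting and affine substitution for integrals over open intervals\<close>

lemma set_nn_integral_split:
  fixes g :: "real \<Rightarrow> ennreal"
  assumes [measurable]: "g \<in> borel_measurable borel" and "a \<le> b" "b \<le> c"
  shows "(\<integral>\<^sup>+x\<in>{a<..<c}. g x \<partial>lborel)
    = (\<integral>\<^sup>+x\<in>{a<..<b}. g x \<partial>lborel) + (\<integral>\<^sup>+x\<in>{b<..<c}. g x \<partial>lborel)"
proof -
  have "(\<integral>\<^sup>+x\<in>{a<..<c}. g x \<partial>lborel)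
    = (\<integral>\<^sup>+x. g x * indicator {a<..<b} x + g x * indicator {b<..<c} x \<partial>lborel)"
    using AE_lborel_singleton[of b]
    by (intro nn_integral_cong_AE, eventually_elim)
      (use \<open>a \<le> b\<close> \<open>b \<le> c\<close> in \<open>auto split: split_indicator\<close>)
  also have "\<dots> = (\<integral>\<^sup>+x\<in>{a<..<b}. g x \<partial>lborel) + (\<integral>\<^sup>+x\<in>{b<..<c}. g x \<partial>lborel)"
    by (rule nn_integral_add) auto
  finally show ?thesis .
qed

lemma set_nn_integral_translate:
  fixes g :: "real \<Rightarrow> ennreal"
  assumes [measurable]: "g \<in> borel_measurable borel"
  shows "(\<integral>\<^sup>+x\<in>{a<..<b}. g (x + s) \<partial>lborel) = (\<integral>\<^sup>+x\<in>{a + s<..<b + s}. g x \<partial>lborel)"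
proof -
  have "(\<integral>\<^sup>+x\<in>{a + s<..<b + s}. g x \<partial>lborel)
    = (\<integral>\<^sup>+x. g (s + x) * indicator {a + s<..<b + s} (s + x) \<partial>lborel)"
    by (subst nn_integral_real_affine[where c = 1 and t = s]) auto
  also have "\<dots> = (\<integral>\<^sup>+x\<in>{a<..<b}. g (x + s) \<partial>lborel)"
    by (intro nn_integral_cong) (auto simp: add.commute split: split_indicator)
  finally show ?thesis ..
qed

lemma set_nn_integral_reflect:
  fixes g :: "real \<Rightarrow> ennreal"
  assumes [measurable]: "g \<in> borel_measurable borel"
  shows "(\<integral>\<^sup>+x\<in>{a<..<b}. g (s - x) \<partial>lborel) = (\<integral>\<^sup>+x\<in>{s - b<..<s - a}. g x \<partial>lborel)"
proof -
  have "(\<integral>\<^sup>+x\<in>{s - b<..<s - a}. g x \<partial>lborel)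
    = (\<integral>\<^sup>+x. g (s - x) * indicator {s - b<..<s - a} (s - x) \<partial>lborel)"
    by (subst nn_integral_real_affine[where c = "-1" and t = s]) auto
  also have "\<dots> = (\<integral>\<^sup>+x\<in>{a<..<b}. g (s - x) \<partial>lborel)"
    by (intro nn_integral_cong) (auto split: split_indicator)
  finally show ?thesis ..
qed

lemma set_nn_integral_cong_Ioo:
  fixes f g :: "real \<Rightarrow> ennreal"
  assumes "\<And>x. a < x \<Longrightarrow> x < b \<Longrightarrow> f x = g x"
  shows "(\<integral>\<^sup>+x\<in>{a<..<b}. f x \<partial>lborel) = (\<integral>\<^sup>+x\<in>{a<..<b}. g x \<partial>lborel)"
  using assms by (intro nn_integral_cong) (auto split: split_indicator)

text \<open>Invariance is tested on integrals rather than on sets, so that for piecewise affine maps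
  it reduces to substitution on each piece.\<close>

lemma distr_rho_eqI:
  assumes f [measurable]: "f \<in> borel_measurable borel" and pos: "\<And>x. 0 < x \<Longrightarrow> 0 < f x"
    and eq: "\<And>g :: real \<Rightarrow> ennreal. g \<in> borel_measurable borel \<Longrightarrow>
      (\<integral>\<^sup>+x\<in>{1<..<4}. g (f x) \<partial>lborel) = (\<integral>\<^sup>+x\<in>{1<..<4}. g x \<partial>lborel)"
  shows "distr \<rho> \<rho> f = \<rho>"
proof (rule measure_eqI)
  fix A assume "A \<in> sets (distr \<rho> \<rho> f)"
  then have A: "A \<in> sets \<rho>" and [measurable]: "A \<in> sets borel" by (auto simp: sets_rho_iff)
  have fm: "f \<in> \<rho> \<rightarrow>\<^sub>M \<rho>" using f pos by (rule measurable_rhoI)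
  have "emeasure (distr \<rho> \<rho> f) A = (\<integral>\<^sup>+x. indicator A x \<partial>distr \<rho> \<rho> f)"
    using A by simp
  also have "\<dots> = (\<integral>\<^sup>+x. indicator A (f x) \<partial>\<rho>)"
    using A by (intro nn_integral_distr fm) auto
  also have "\<dots> = (\<integral>\<^sup>+x. indicator A x \<partial>\<rho>)"
    by (simp add: nn_integral_rho eq)
  also have "\<dots> = emeasure \<rho> A"
    using A by simp
  finally show "emeasure (distr \<rho> \<rho> f) A = emeasure \<rho> A" .
qed simp

section \<open>The $DDI$-map of the uniform measure\<close>

definition ddi :: "real \<Rightarrow> real" where
  "ddi x = (if 1 < x \<and> x < 2 then 4 - x else if 2 < x \<and> x < 3 then 6 - x
            else if 3 < x \<and> x < 4 then x - 2 else x)"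

text \<open>
  Off the three open intervals \<open>ddi\<close> is the identity, so that \<open>ddi\<^sup>3 = id\<close> holds everywhere.
\<close>

lemma ddi_measurable [measurable]: "ddi \<in> borel_measurable borel"
  unfolding ddi_def[abs_def] by measurable

lemma ddi_pos: "0 < x \<Longrightarrow> 0 < ddi x"
  by (auto simp: ddi_def)

lemma ddi_ddi_ddi [simp]: "ddi (ddi (ddi x)) = x"
  by (auto simp: ddi_def)

lemma set_nn_integral_thirds:
  fixes g :: "real \<Rightarrow> ennreal"
  assumes "g \<in> borel_measurable borel"
  shows "(\<integral>\<^sup>+x\<in>{1<..<4}. g x \<partial>lborel) = (\<integral>\<^sup>+x\<in>{1<..<2}. g x \<partial>lborel)
    + (\<integral>\<^sup>+x\<in>{2<..<3}. g x \<partial>lborel) + (\<integral>\<^sup>+x\<in>{3<..<4}. g x \<partial>lborel)"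
  using assms set_nn_integral_split[of g 1 3 4] set_nn_integral_split[of g 1 2 3] by simp

lemma distr_ddi: "distr \<rho> \<rho> ddi = \<rho>"
proof (rule distr_rho_eqI[OF ddi_measurable ddi_pos])
  fix g :: "real \<Rightarrow> ennreal" assume [measurable]: "g \<in> borel_measurable borel"
  have "(\<integral>\<^sup>+x\<in>{1<..<2}. g (ddi x) \<partial>lborel) = (\<integral>\<^sup>+x\<in>{1<..<2}. g (4 - x) \<partial>lborel)"
    "(\<integral>\<^sup>+x\<in>{2<..<3}. g (ddi x) \<partial>lborel) = (\<integral>\<^sup>+x\<in>{2<..<3}. g (6 - x) \<partial>lborel)"
    "(\<integral>\<^sup>+x\<in>{3<..<4}. g (ddi x) \<partial>lborel) = (\<integral>\<^sup>+x\<in>{3<..<4}. g (x + -2) \<partial>lborel)"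
    by (intro set_nn_integral_cong_Ioo; simp add: ddi_def)+
  then show "(\<integral>\<^sup>+x\<in>{1<..<4}. g (ddi x) \<partial>lborel) = (\<integral>\<^sup>+x\<in>{1<..<4}. g x \<partial>lborel)"
    using set_nn_integral_reflect[where g = g and a = 1 and b = 2 and s = 4]
      set_nn_integral_reflect[where g = g and a = 2 and b = 3 and s = 6]
      set_nn_integral_translate[where g = g and a = 3 and b = 4 and s = "-2"]
    by (simp add: set_nn_integral_thirds add_ac)
qed

section \<open>Uniqueness and existence of the monotone transports\<close>

lemma transport_iff_emeasure:
  assumes T: "T \<in> \<rho> \<rightarrow>\<^sub>M \<rho>" and I: "I \<in> sets \<rho>" and J: "J \<in> sets \<rho>"
  shows "distr (density \<rho> (indicator I)) \<rho> T = density \<rho> (indicator J) \<longleftrightarrow>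
    (\<forall>B\<in>sets \<rho>. emeasure \<rho> (I \<inter> (T -` B \<inter> space \<rho>)) = emeasure \<rho> (J \<inter> B))" (is "?L = ?R \<longleftrightarrow> _")
proof -
  have "emeasure ?L B = emeasure \<rho> (I \<inter> (T -` B \<inter> space \<rho>))" "emeasure ?R B = emeasure \<rho> (J \<inter> B)"
    if B: "B \<in> sets \<rho>" for B
    using T I J B measurable_sets[OF T B] by (simp_all add: emeasure_distr emeasure_restricted)
  moreover have "?L = ?R \<longleftrightarrow> (\<forall>B\<in>sets \<rho>. emeasure ?L B = emeasure ?R B)"
    by (auto intro!: measure_eqI)
  ultimately show ?thesis by simp
qed

text \<open>Up to a null set \<open>T\<close> carries the interval into \<open>B\<close>, so the
  mass of the interval is at most that of \<open>J \<inter> B\<close>. In the applications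
  \<open>B\<close> is a ray ending at a value of \<open>T\<close>.\<close>

lemma transport_ray:
  assumes T: "T \<in> \<rho> \<rightarrow>\<^sub>M \<rho>" and I: "I \<in> sets \<rho>" and J: "J \<in> sets \<rho>"
    and tr: "distr (density \<rho> (indicator I)) \<rho> T = density \<rho> (indicator J)"
    and N: "N \<in> null_sets \<rho>"
    and lu: "1 \<le> l" "l < u" "u \<le> 4" "{l<..<u} \<subseteq> I"
    and B: "B \<in> sets borel" "J \<inter> {1<..<4} \<inter> B \<subseteq> {l'..u'}"
    and TB: "\<And>y. y \<in> {l<..<u} - N \<Longrightarrow> T y \<in> B"
  shows "u - l \<le> u' - l'"
proof -
  let ?B = "B \<inter> {0<..}"
  have B': "?B \<in> sets \<rho>" using B by (simp add: sets_rho_iff)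
  have lu_eq: "{l<..<u} \<inter> {1<..<4} = {l<..<u}" using lu by auto
  have lu_sets: "{l<..<u} \<in> sets \<rho>" using lu by (auto simp: sets_rho_iff)
  have "ennreal (1 / 3) * ennreal (u - l) = emeasure \<rho> {l<..<u}"
    using lu lu_eq by (subst emeasure_rho) auto
  also have "\<dots> = emeasure \<rho> ({l<..<u} - N)"
    using emeasure_Diff_null_set[OF N lu_sets] by simp
  also have "\<dots> \<le> emeasure \<rho> (I \<inter> (T -` ?B \<inter> space \<rho>))"
    using lu measurable_space[OF T] TB measurable_sets[OF T B'] I
    by (intro emeasure_mono) (auto simp del: vimage_Int)
  also have "\<dots> = emeasure \<rho> (J \<inter> ?B)"
    using tr[unfolded transport_iff_emeasure[OF T I J]] B' by (rule bspec)
  also have "\<dots> = ennreal (1 / 3) * emeasure lborel (J \<inter> ?B \<inter> {1<..<4})"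
    using J B by (intro emeasure_rho) (auto simp: sets_rho_iff)
  also have "\<dots> \<le> ennreal (1 / 3) * emeasure lborel {l'..u'}"
    using B by (intro mult_left_mono emeasure_mono) auto
  also have "\<dots> = ennreal (1 / 3) * ennreal (u' - l')"
    by (simp add: emeasure_lborel_Icc_eq ennreal_neg)
  finally have "ennreal (1 / 3 * (u - l)) \<le> ennreal (1 / 3 * (u' - l'))"
    by (simp only: ennreal_mult' zero_le_divide_iff zero_le_numeral zero_le_one simp_thms)
  \<comment> \<open>The length \<open>u' - l'\<close> might a priori be negative and truncated to 0
    by \<open>ennreal\<close>; \<open>l < u\<close> excludes this.\<close>
  then show ?thesis
    using lu by (subst (asm) ennreal_le_iff2) auto
qed

text \<open>
  Comparing the masses of the parts of \<open>I\<close> to the left and to the right of \<open>x\<close> with those of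
  their images bounds \<open>T x\<close> from both sides.
\<close>

lemma decreasing_transport_unique:
  assumes T: "T \<in> \<rho> \<rightarrow>\<^sub>M \<rho>" and I: "I \<in> sets \<rho>" and J: "J \<in> sets \<rho>"
    and tr: "decreasing_transport \<rho> T I J"
    and a: "1 \<le> a" "a \<le> 3" "{a<..<a + 1} \<subseteq> I" and b: "J \<inter> {1<..<4} \<subseteq> {b..b + 1}"
  shows "AE x in \<rho>. a < x \<longrightarrow> x < a + 1 \<longrightarrow> T x = a + b + 1 - x"
proof -
  obtain N where N: "N \<in> null_sets \<rho>" and mono: "monotone_on (I - N) (\<le>) (\<ge>) T"
    and eq: "distr (density \<rho> (indicator I)) \<rho> T = density \<rho> (indicator J)"
    using tr by (auto simp: monotone_transport_def)
  show ?thesis using AE_not_in[OF N]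
  proof eventually_elim
    fix x assume xN: "x \<notin> N"
    show "a < x \<longrightarrow> x < a + 1 \<longrightarrow> T x = a + b + 1 - x"
    proof (intro impI)
      assume x: "a < x" "x < a + 1"
      then have "x \<in> I - N" using a xN by auto
      then have below: "T x \<le> T y" if "y \<in> {a<..<x} - N" for y
        using that x a by (intro monotone_onD[OF mono, of y x]) auto
      have above: "T y \<le> T x" if "y \<in> {x<..<a + 1} - N" for y
        using that x a \<open>x \<in> I - N\<close> by (intro monotone_onD[OF mono, of x y]) auto
      \<comment> \<open>Points to the left of \<open>x\<close> land in \<open>{T x..}\<close>, those
        to the right in \<open>{..T x}\<close>. As source and target windows both have length 1, the
        two bounds leave a single value for \<open>T x\<close>.\<close>
      have "x - a \<le> (b + 1) - T x"
        using x a b below above by (intro transport_ray[OF T I J eq N, of a x "{T x..}"]) auto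
      moreover have "(a + 1) - x \<le> T x - b"
        using x a b below above by (intro transport_ray[OF T I J eq N, of x "a + 1" "{..T x}"]) auto
      ultimately show "T x = a + b + 1 - x" by linarith
    qed
  qed
qed

text \<open>The argument of the decreasing case with the two rays interchanged.\<close>

lemma increasing_transport_unique:
  assumes T: "T \<in> \<rho> \<rightarrow>\<^sub>M \<rho>" and I: "I \<in> sets \<rho>" and J: "J \<in> sets \<rho>"
    and tr: "increasing_transport \<rho> T I J"
    and a: "1 \<le> a" "a \<le> 3" "{a<..<a + 1} \<subseteq> I" and b: "J \<inter> {1<..<4} \<subseteq> {b..b + 1}"
  shows "AE x in \<rho>. a < x \<longrightarrow> x < a + 1 \<longrightarrow> T x = x + b - a"
proof -
  obtain N where N: "N \<in> null_sets \<rho>" and mono: "monotone_on (I - N) (\<le>) (\<le>) T"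
    and eq: "distr (density \<rho> (indicator I)) \<rho> T = density \<rho> (indicator J)"
    using tr by (auto simp: monotone_transport_def)
  show ?thesis using AE_not_in[OF N]
  proof eventually_elim
    fix x assume xN: "x \<notin> N"
    show "a < x \<longrightarrow> x < a + 1 \<longrightarrow> T x = x + b - a"
    proof (intro impI)
      assume x: "a < x" "x < a + 1"
      then have "x \<in> I - N" using a xN by auto
      then have below: "T y \<le> T x" if "y \<in> {a<..<x} - N" for y
        using that x a by (intro monotone_onD[OF mono, of y x]) auto
      have above: "T x \<le> T y" if "y \<in> {x<..<a + 1} - N" for y
        using that x a \<open>x \<in> I - N\<close> by (intro monotone_onD[OF mono, of x y]) auto
      have "x - a \<le> T x - b"
        using x a b below above by (intro transport_ray[OF T I J eq N, of a x "{..T x}"]) auto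
      moreover have "(a + 1) - x \<le> (b + 1) - T x"
        using x a b below above by (intro transport_ray[OF T I J eq N, of x "a + 1" "{T x..}"]) auto
      ultimately show "T x = x + b - a" by linarith
    qed
  qed
qed

lemma measure_rho:
  assumes "A \<in> sets borel" "A \<subseteq> {0<..}"
  shows "measure \<rho> A = measure lborel (A \<inter> {1<..<4}) / 3"
  using emeasure_rho[OF assms] by (simp add: measure_def enn2real_mult)

text \<open>On [1,4] the distribution function is strictly increasing, which fixes the cuts. Cuts
  beyond that interval have to be excluded separately: there the masses in question are 0 or exceed
  1/3.\<close>

lemma ddi_cuts:
  assumes "measure \<rho> {0<..d1} = 1 / 3" "measure \<rho> {d1..d2} = 1 / 3" "0 < d1"
  shows "d1 = 2" "d2 = 3"
proof -
  have m1: "measure lborel ({0<..d1} \<inter> {1<..<4}) = 1"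
    using assms(1) by (subst (asm) measure_rho) auto
  show d1: "d1 = 2"
  proof -
    consider "d1 \<le> 1" | "1 < d1" "d1 < 4" | "4 \<le> d1" by linarith
    then show ?thesis
    proof cases
      case 1
      then have "{0<..d1} \<inter> {1<..<4} = {}" by auto
      with m1 show ?thesis by simp
    next
      case 2
      then have "{0<..d1} \<inter> {1<..<4} = {1<..d1}" by auto
      with m1 2 show ?thesis by simp
    next
      case 3
      then have "{0<..d1} \<inter> {1<..<4} = {1<..<4}" by auto
      with m1 show ?thesis by simp
    qed
  qed
  have m2: "measure lborel ({2..d2} \<inter> {1<..<4}) = 1"
    using assms(2) d1 by (subst (asm) measure_rho) auto
  consider "d2 < 2" | "2 \<le> d2" "d2 < 4" | "4 \<le> d2" by linarith
  then show "d2 = 3"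
  proof cases
    case 1
    then have "{2..d2} \<inter> {1<..<4} = {}" by auto
    with m2 show ?thesis by simp
  next
    case 2
    then have "{2..d2} \<inter> {1<..<4} = {2..d2}" by auto
    with m2 2 show ?thesis by simp
  next
    case 3
    then have "{2..d2} \<inter> {1<..<4} = {2..<4}" by auto
    with m2 show ?thesis by simp
  qed
qed

lemma DDI_map_unique:
  assumes "DDI_map \<rho> T"
  shows "AE x in \<rho>. T x = ddi x"
proof -
  have T: "T \<in> \<rho> \<rightarrow>\<^sub>M \<rho>" using assms by (simp add: DDI_map_def)
  obtain d1 d2 where "d1 > 0" "measure \<rho> {0<..d1} = 1 / 3" "measure \<rho> {d1..d2} = 1 / 3"
    and tr: "decreasing_transport \<rho> T {0<..<d1} {d1<..<d2}"
      "decreasing_transport \<rho> T {d1<..<d2} {d2<..}" "increasing_transport \<rho> T {d2<..} {0<..<d1}"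
    using assms unfolding DDI_map_def by blast
  with ddi_cuts have "d1 = 2" "d2 = 3" by blast+
  note tr = tr[unfolded this]
  have S: "{0<..<2} \<in> sets \<rho>" "{2<..<3} \<in> sets \<rho>" "{3<..} \<in> sets \<rho>"
    by (auto simp: sets_rho_iff)
  have "AE x in \<rho>. 1 < x \<longrightarrow> x < 1 + 1 \<longrightarrow> T x = 1 + 2 + 1 - x"
    \<comment> \<open>The sums stay unevaluated so that they unify with \<open>a + 1\<close> and
      \<open>a + b + 1 - x\<close>, where \<open>a\<close> and \<open>b\<close> are the left ends of
      the source and target windows.\<close>
    by (rule decreasing_transport_unique[OF T S(1,2) tr(1)]) auto
  moreover have "AE x in \<rho>. 2 < x \<longrightarrow> x < 2 + 1 \<longrightarrow> T x = 2 + 3 + 1 - x"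
    by (rule decreasing_transport_unique[OF T S(2,3) tr(2)]) auto
  moreover have "AE x in \<rho>. 3 < x \<longrightarrow> x < 3 + 1 \<longrightarrow> T x = x + 1 - 3"
    by (rule increasing_transport_unique[OF T S(3,1) tr(3)]) auto
  ultimately show ?thesis using AE_rho_interior
    by eventually_elim (auto simp: ddi_def)
qed

text \<open>Up to a null set \<open>I\<close> is the preimage of \<open>J\<close>, so
  \<open>I\<close> intersected with the preimage of \<open>B\<close> is the preimage of
  \<open>J \<inter> B\<close>. Invariance of \<open>\<rho>\<close> under \<open>ddi\<close> then
  gives the claim.\<close>

lemma ddi_transport:
  assumes I: "I \<in> sets \<rho>" and J: "J \<in> sets \<rho>"
    and IJ: "\<And>x. 1 < x \<Longrightarrow> x < 4 \<Longrightarrow> x \<noteq> 2 \<Longrightarrow> x \<noteq> 3 \<Longrightarrow> x \<in> I \<longleftrightarrow> ddi x \<in> J"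
  shows "distr (density \<rho> (indicator I)) \<rho> ddi = density \<rho> (indicator J)"
proof -
  have m: "ddi \<in> \<rho> \<rightarrow>\<^sub>M \<rho>" by (rule measurable_rhoI[OF ddi_measurable ddi_pos])
  have "emeasure \<rho> (I \<inter> (ddi -` B \<inter> space \<rho>)) = emeasure \<rho> (J \<inter> B)" if B: "B \<in> sets \<rho>" for B
  proof -
    have "emeasure \<rho> (I \<inter> (ddi -` B \<inter> space \<rho>)) = emeasure \<rho> (ddi -` (J \<inter> B) \<inter> space \<rho>)"
    proof (rule emeasure_eq_AE)
      show "AE x in \<rho>. x \<in> I \<inter> (ddi -` B \<inter> space \<rho>) \<longleftrightarrow> x \<in> ddi -` (J \<inter> B) \<inter> space \<rho>"
        using AE_rho_interior by eventually_elim (auto simp: IJ)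
      show "I \<inter> (ddi -` B \<inter> space \<rho>) \<in> sets \<rho>"
        using I measurable_sets[OF m B] by (rule sets.Int)
      show "ddi -` (J \<inter> B) \<inter> space \<rho> \<in> sets \<rho>"
        using J B by (intro measurable_sets[OF m] sets.Int)
    qed
    also have "\<dots> = emeasure (distr \<rho> \<rho> ddi) (J \<inter> B)"
      using m J B by (simp add: emeasure_distr)
    finally show ?thesis by (simp add: distr_ddi)
  qed
  then show ?thesis by (simp add: transport_iff_emeasure[OF m I J])
qed

lemma DDI_map_ddi: "DDI_map \<rho> ddi"
proof -
  have m: "ddi \<in> \<rho> \<rightarrow>\<^sub>M \<rho>" by (rule measurable_rhoI[OF ddi_measurable ddi_pos])
  have "{0<..2} \<inter> {1<..<4} = {1<..2::real}" "{2..3} \<inter> {1<..<4} = {2..3::real}"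
    "{3..} \<inter> {1<..<4} = {3..<4::real}" by auto
  then have cuts: "measure \<rho> {0<..2} = 1 / 3" "measure \<rho> {2..3} = 1 / 3" "measure \<rho> {3..} = 1 / 3"
    by (subst measure_rho; force)+
  \<comment> \<open>Outside the support \<open>ddi\<close> is the identity, which would spoil the
    monotonicity; this set serves as the exceptional null set.\<close>
  have N: "{0<..1} \<union> {4..} \<in> null_sets \<rho>"
  proof -
    have "({0<..1::real} \<union> {4..}) \<inter> {1<..<4} = {}" by auto
    then have "emeasure \<rho> ({0<..1} \<union> {4..}) = 0"
      by (subst emeasure_rho) auto
    then show ?thesis by (auto simp: null_sets_def sets_rho_iff)
  qed
  have S: "{0<..<2} \<in> sets \<rho>" "{2<..<3} \<in> sets \<rho>" "{3<..} \<in> sets \<rho>"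
    by (auto simp: sets_rho_iff)
  have "decreasing_transport \<rho> ddi {0<..<2} {2<..<3}"
    unfolding monotone_transport_def
    by (intro conjI bexI[OF _ N] ddi_transport S) (auto simp: monotone_on_def ddi_def)
  moreover have "decreasing_transport \<rho> ddi {2<..<3} {3<..}"
    unfolding monotone_transport_def
    by (intro conjI bexI[OF _ N] ddi_transport S) (auto simp: monotone_on_def ddi_def)
  moreover have "increasing_transport \<rho> ddi {3<..} {0<..<2}"
    unfolding monotone_transport_def
    by (intro conjI bexI[OF _ N] ddi_transport S) (auto simp: monotone_on_def ddi_def)
  ultimately show ?thesis
    unfolding DDI_map_def using m distr_ddi nonatomic_prob_rho cuts
    by (intro conjI exI[of _ 2] exI[of _ 3]) simp_all
qed

section \<open>The competitor\<close>

text \<open>The windows contain the largest radii \<open>t + 2\<close> of the orbits with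
  \<open>t\<close> within 1/1000 of 1 and of 2. This width is small enough for the cost estimates to
  hold uniformly. The radii below 3 stay fixed.\<close>

definition exch :: "real \<Rightarrow> real" where
  "exch x = (if 3 < x \<and> x < 3.001 then x + 0.999 else if 3.999 < x \<and> x < 4 then x - 0.999 else x)"

lemma exch_measurable [measurable]: "exch \<in> borel_measurable borel"
  unfolding exch_def[abs_def] by measurable

lemma exch_pos: "0 < x \<Longrightarrow> 0 < exch x"
  by (auto simp: exch_def)

lemma exch_exch [simp]: "exch (exch x) = x"
  by (auto simp: exch_def)

lemma distr_exch: "distr \<rho> \<rho> exch = \<rho>"
proof (rule distr_rho_eqI[OF exch_measurable exch_pos])
  fix g :: "real \<Rightarrow> ennreal" assume g [measurable]: "g \<in> borel_measurable borel"
  have split: "(\<integral>\<^sup>+x\<in>{1<..<4}. f x \<partial>lborel) = (\<integral>\<^sup>+x\<in>{1<..<3}. f x \<partial>lborel)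
      + (\<integral>\<^sup>+x\<in>{3<..<3.001}. f x \<partial>lborel) + (\<integral>\<^sup>+x\<in>{3.001<..<3.999}. f x \<partial>lborel)
      + (\<integral>\<^sup>+x\<in>{3.999<..<4}. f x \<partial>lborel)"
    if "f \<in> borel_measurable borel" for f :: "real \<Rightarrow> ennreal"
    using that set_nn_integral_split[of f 1 3 4] set_nn_integral_split[of f 3 "3.001" 4]
      set_nn_integral_split[of f "3.001" "3.999" 4] by (simp add: add_ac)
  have "(\<integral>\<^sup>+x\<in>{1<..<3}. g (exch x) \<partial>lborel) = (\<integral>\<^sup>+x\<in>{1<..<3}. g x \<partial>lborel)"
    "(\<integral>\<^sup>+x\<in>{3<..<3.001}. g (exch x) \<partial>lborel) = (\<integral>\<^sup>+x\<in>{3<..<3.001}. g (x + 0.999) \<partial>lborel)"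
    "(\<integral>\<^sup>+x\<in>{3.001<..<3.999}. g (exch x) \<partial>lborel) = (\<integral>\<^sup>+x\<in>{3.001<..<3.999}. g x \<partial>lborel)"
    "(\<integral>\<^sup>+x\<in>{3.999<..<4}. g (exch x) \<partial>lborel) = (\<integral>\<^sup>+x\<in>{3.999<..<4}. g (x + - 0.999) \<partial>lborel)"
    by (intro set_nn_integral_cong_Ioo; simp add: exch_def)+
  moreover have "(\<integral>\<^sup>+x\<in>{3<..<3.001}. g (x + 0.999) \<partial>lborel) = (\<integral>\<^sup>+x\<in>{3.999<..<4}. g x \<partial>lborel)"
    using set_nn_integral_translate[OF g, where a = 3 and b = "3.001" and s = "0.999"] by simp
  moreover have "(\<integral>\<^sup>+x\<in>{3.999<..<4}. g (x + - 0.999) \<partial>lborel) = (\<integral>\<^sup>+x\<in>{3<..<3.001}. g x \<partial>lborel)"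
    using set_nn_integral_translate[OF g, where a = "3.999" and b = 4 and s = "- 0.999"] by simp
  ultimately show "(\<integral>\<^sup>+x\<in>{1<..<4}. g (exch x) \<partial>lborel) = (\<integral>\<^sup>+x\<in>{1<..<4}. g x \<partial>lborel)"
    by (subst (1 2) split) (simp_all only: measurable_compose[OF exch_measurable g] g add_ac)
qed

text \<open>As \<open>s\<close> is an involution, the square of the conjugate is the conjugate of
  the square, and invariance of \<open>\<rho>\<close> removes the inner \<open>s\<close>. The
  remaining integrand is constant along \<open>ddi\<close>-orbits, so the three thirds contribute
  equally and cancel the density 1/3.\<close>

lemma monge_cost_conjugate:
  assumes s [measurable]: "s \<in> borel_measurable borel" and pos: "\<And>x. 0 < x \<Longrightarrow> 0 < s x"
    and invol: "\<And>x. s (s x) = x" and distr_s: "distr \<rho> \<rho> s = \<rho>"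
  shows "monge_cost \<rho> (s \<circ> ddi \<circ> s) = (\<integral>\<^sup>+x\<in>{1<..<2}. cost (s x) (s (4 - x)) (s (x + 2)) \<partial>lborel)"
proof -
  define G where "G x = polar_cost (s x, s (ddi x), s (ddi (ddi x)))" for x
  have G [measurable]: "G \<in> borel_measurable borel"
    unfolding G_def[abs_def] by measurable
  have G_eq: "G x = cost (s x) (s (ddi x)) (s (ddi (ddi x)))" if "0 < x" for x
    using that by (simp add: G_def cost_eq_polar_cost pos ddi_pos)
  have G_ddi: "G (ddi x) = G x" if "0 < x" for x
    using that cost_rotate[of "s x"] by (simp add: G_eq ddi_pos)
  have triple: "z + z + z = ennreal 3 * z" for z :: ennreal
    using distrib_right[of 2 1 z] by (simp add: mult_2)
  have sm: "s \<in> \<rho> \<rightarrow>\<^sub>M \<rho>" by (rule measurable_rhoI[OF s pos])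
  have "monge_cost \<rho> (s \<circ> ddi \<circ> s) = (\<integral>\<^sup>+x. G (s x) \<partial>\<rho>)"
    unfolding monge_cost_def
    by (intro nn_integral_cong) (simp add: G_eq pos invol numeral_2_eq_2)
  also have "\<dots> = (\<integral>\<^sup>+x. G x \<partial>distr \<rho> \<rho> s)"
    using G by (intro nn_integral_distr[symmetric] sm) (simp add: measurable_rho_borel)
  also have "\<dots> = (\<integral>\<^sup>+x. G x \<partial>\<rho>)"
    by (simp only: distr_s)
  also have "\<dots> = ennreal (1 / 3) * ((\<integral>\<^sup>+x\<in>{1<..<2}. G x \<partial>lborel)
    + (\<integral>\<^sup>+x\<in>{2<..<3}. G x \<partial>lborel) + (\<integral>\<^sup>+x\<in>{3<..<4}. G x \<partial>lborel))"
    by (simp add: nn_integral_rho set_nn_integral_thirds)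
  also have "(\<integral>\<^sup>+x\<in>{2<..<3}. G x \<partial>lborel) = (\<integral>\<^sup>+x\<in>{1<..<2}. G (4 - x) \<partial>lborel)"
    using set_nn_integral_reflect[OF G, where a = 1 and b = 2 and s = 4] by simp
  also have "\<dots> = (\<integral>\<^sup>+x\<in>{1<..<2}. G (ddi x) \<partial>lborel)"
    by (intro set_nn_integral_cong_Ioo) (simp add: ddi_def)
  also have "\<dots> = (\<integral>\<^sup>+x\<in>{1<..<2}. G x \<partial>lborel)"
    by (intro set_nn_integral_cong_Ioo) (simp add: G_ddi)
  also have "(\<integral>\<^sup>+x\<in>{3<..<4}. G x \<partial>lborel) = (\<integral>\<^sup>+x\<in>{1<..<2}. G (x + 2) \<partial>lborel)"
    using set_nn_integral_translate[OF G, where a = 1 and b = 2 and s = 2] by simp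
  also have "\<dots> = (\<integral>\<^sup>+x\<in>{1<..<2}. G (ddi (ddi x)) \<partial>lborel)"
    by (intro set_nn_integral_cong_Ioo) (simp add: ddi_def add.commute)
  also have "\<dots> = (\<integral>\<^sup>+x\<in>{1<..<2}. G x \<partial>lborel)"
    by (intro set_nn_integral_cong_Ioo) (simp add: G_ddi ddi_pos)
  also have "(\<integral>\<^sup>+x\<in>{1<..<2}. G x \<partial>lborel) + (\<integral>\<^sup>+x\<in>{1<..<2}. G x \<partial>lborel)
      + (\<integral>\<^sup>+x\<in>{1<..<2}. G x \<partial>lborel) = ennreal 3 * (\<integral>\<^sup>+x\<in>{1<..<2}. G x \<partial>lborel)"
    by (rule triple)
  also have "ennreal (1 / 3) * \<dots> = (\<integral>\<^sup>+x\<in>{1<..<2}. G x \<partial>lborel)"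
    by (simp add: mult.assoc[symmetric] ennreal_mult[symmetric] del: ennreal_numeral)
  also have "\<dots> = (\<integral>\<^sup>+x\<in>{1<..<2}. cost (s x) (s (4 - x)) (s (x + 2)) \<partial>lborel)"
    by (intro set_nn_integral_cong_Ioo) (simp add: G_eq ddi_def add.commute)
  finally show ?thesis .
qed

lemma set_nn_integral_ge_const:
  assumes "a \<le> b" "\<And>x. a < x \<Longrightarrow> x < b \<Longrightarrow> k \<le> f x"
  shows "k * ennreal (b - a) \<le> (\<integral>\<^sup>+x\<in>{a<..<b}. f x \<partial>lborel)"
proof -
  have "k * ennreal (b - a) = (\<integral>\<^sup>+x\<in>{a<..<b}. k \<partial>lborel)"
    using assms by (simp add: nn_integral_cmult_indicator)
  also have "\<dots> \<le> (\<integral>\<^sup>+x\<in>{a<..<b}. f x \<partial>lborel)"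
    using assms by (intro nn_integral_mono) (auto split: split_indicator)
  finally show ?thesis .
qed

lemma set_nn_integral_le_const:
  assumes "a \<le> b" "\<And>x. a < x \<Longrightarrow> x < b \<Longrightarrow> f x \<le> k"
  shows "(\<integral>\<^sup>+x\<in>{a<..<b}. f x \<partial>lborel) \<le> k * ennreal (b - a)"
proof -
  have "(\<integral>\<^sup>+x\<in>{a<..<b}. f x \<partial>lborel) \<le> (\<integral>\<^sup>+x\<in>{a<..<b}. k \<partial>lborel)"
    using assms by (intro nn_integral_mono) (auto split: split_indicator)
  also have "\<dots> = k * ennreal (b - a)"
    using assms by (simp add: nn_integral_cmult_indicator)
  finally show ?thesis .
qed

text \<open>Both costs are integrals over the orbit parameter \<open>t\<close> in (1,2), and the
  integrands agree except within 1/1000 of the ends. There the cost estimates give 0.6584 + 0.7464 =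
  1.4048 after the exchange against 0.7469 + 0.6618 = 1.4087 before it.\<close>

lemma exch_improves: "monge_cost \<rho> (exch \<circ> ddi \<circ> exch) < monge_cost \<rho> ddi"
proof -
  define F where "F x = polar_cost (x, 4 - x, x + 2)" for x
  define G where "G x = polar_cost (x, 4 - x, exch (x + 2))" for x
  have FG [measurable]: "F \<in> borel_measurable borel" "G \<in> borel_measurable borel"
    unfolding F_def[abs_def] G_def[abs_def] by measurable
  have F: "F x = cost x (4 - x) (x + 2)" and G: "G x = cost x (4 - x) (exch (x + 2))"
    if "1 < x" "x < 2" for x
    using that by (simp_all add: F_def G_def cost_eq_polar_cost exch_pos)
  have "monge_cost \<rho> ddi = (\<integral>\<^sup>+x\<in>{1<..<2}. cost x (4 - x) (x + 2) \<partial>lborel)"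
    using monge_cost_conjugate[of "\<lambda>x. x"] distr_id2[of \<rho> \<rho>] by (simp add: comp_def)
  also have "\<dots> = (\<integral>\<^sup>+x\<in>{1<..<2}. F x \<partial>lborel)"
    by (intro set_nn_integral_cong_Ioo) (simp add: F)
  finally have cF: "monge_cost \<rho> ddi = (\<integral>\<^sup>+x\<in>{1<..<2}. F x \<partial>lborel)" .
  have "monge_cost \<rho> (exch \<circ> ddi \<circ> exch)
    = (\<integral>\<^sup>+x\<in>{1<..<2}. cost (exch x) (exch (4 - x)) (exch (x + 2)) \<partial>lborel)"
    by (intro monge_cost_conjugate exch_measurable exch_pos distr_exch) auto
  also have "\<dots> = (\<integral>\<^sup>+x\<in>{1<..<2}. G x \<partial>lborel)"
  proof (intro set_nn_integral_cong_Ioo)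
    fix x :: real assume "1 < x" "x < 2"
    then show "cost (exch x) (exch (4 - x)) (exch (x + 2)) = G x"
      by (simp add: G exch_def[of x] exch_def[of "4 - x"])
  qed
  finally have cG: "monge_cost \<rho> (exch \<circ> ddi \<circ> exch) = (\<integral>\<^sup>+x\<in>{1<..<2}. G x \<partial>lborel)" .
  have split: "(\<integral>\<^sup>+x\<in>{1<..<2}. f x \<partial>lborel) = (\<integral>\<^sup>+x\<in>{1.001<..<1.999}. f x \<partial>lborel)
      + ((\<integral>\<^sup>+x\<in>{1<..<1.001}. f x \<partial>lborel) + (\<integral>\<^sup>+x\<in>{1.999<..<2}. f x \<partial>lborel))"
    if "f \<in> borel_measurable borel" for f :: "real \<Rightarrow> ennreal"
    using that set_nn_integral_split[of f 1 "1.001" 2] set_nn_integral_split[of f "1.001" "1.999" 2]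
    by (simp add: add_ac)
  have lin: "ennreal a * ennreal b + ennreal c * ennreal d = ennreal (a * b + c * d)"
    if "0 \<le> a" "0 \<le> b" "0 \<le> c" "0 \<le> d" for a b c d
    using that by (simp add: ennreal_mult ennreal_plus)
  have mid: "(\<integral>\<^sup>+x\<in>{1.001<..<1.999}. G x \<partial>lborel) = (\<integral>\<^sup>+x\<in>{1.001<..<1.999}. F x \<partial>lborel)"
    by (intro set_nn_integral_cong_Ioo) (simp add: F G exch_def)
  \<comment> \<open>The attribute \<open>simplified\<close> brings the numerals of the cost
    estimates into the normal form that \<open>auto\<close> produces in the goals.\<close>
  have "(\<integral>\<^sup>+x\<in>{1.001<..<1.999}. F x \<partial>lborel) \<le> ennreal 3 * ennreal (1.999 - 1.001)"
    by (rule set_nn_integral_le_const) (auto simp: F intro!: cost_le_3[simplified])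
  then have fin: "(\<integral>\<^sup>+x\<in>{1.001<..<1.999}. F x \<partial>lborel) < \<top>"
    by (rule order_le_less_trans) (simp add: ennreal_mult_less_top)
  have "(\<integral>\<^sup>+x\<in>{1<..<1.001}. G x \<partial>lborel) \<le> ennreal 0.6584 * ennreal (1.001 - 1)"
    by (rule set_nn_integral_le_const) (auto simp: G exch_def intro!: cost_le_1_3_4[simplified])
  moreover have "(\<integral>\<^sup>+x\<in>{1.999<..<2}. G x \<partial>lborel) \<le> ennreal 0.7464 * ennreal (2 - 1.999)"
    by (rule set_nn_integral_le_const) (auto simp: G exch_def intro!: cost_le_2_2_3[simplified])
  ultimately have "(\<integral>\<^sup>+x\<in>{1<..<1.001}. G x \<partial>lborel) + (\<integral>\<^sup>+x\<in>{1.999<..<2}. G x \<partial>lborel)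
      \<le> ennreal 0.6584 * ennreal (1.001 - 1) + ennreal 0.7464 * ennreal (2 - 1.999)"
    by (rule add_mono)
  also have "\<dots> = ennreal (0.6584 * (1.001 - 1) + 0.7464 * (2 - 1.999))"
    by (rule lin) simp_all
  also have "\<dots> < ennreal (0.7469 * (1.001 - 1) + 0.6618 * (2 - 1.999))"
    by (intro ennreal_lessI) simp_all
  also have "\<dots> = ennreal 0.7469 * ennreal (1.001 - 1) + ennreal 0.6618 * ennreal (2 - 1.999)"
    by (rule lin[symmetric]) simp_all
  also have "\<dots> \<le> (\<integral>\<^sup>+x\<in>{1<..<1.001}. F x \<partial>lborel) + (\<integral>\<^sup>+x\<in>{1.999<..<2}. F x \<partial>lborel)"
    by (intro add_mono set_nn_integral_ge_const)
      (auto simp: F intro!: cost_ge_1_3_3[simplified] cost_ge_2_2_4[simplified])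
  finally show ?thesis
    unfolding cF cG split[OF FG(1)] split[OF FG(2)] mid
    using fin by (simp add: ennreal_add_left_cancel_less)
qed

section \<open>The support of the plan and the failure of c-monotonicity\<close>

text \<open>As a combination of fixed vectors the triple is accessible to the continuity and
  measurability rules.\<close>

lemma vector_3_scaleR: "(vector [a, b, c] :: real^3) = a *\<^sub>R axis 1 1 + b *\<^sub>R axis 2 1 + c *\<^sub>R axis 3 1"
  by (simp add: vec_eq_iff forall_3 axis_def)

lemma measurable_rho_into_borel:
  assumes "T \<in> \<rho> \<rightarrow>\<^sub>M \<rho>"
  shows "T \<in> borel_measurable \<rho>"
  using measurable_compose[OF assms measurable_rho_borel[of "\<lambda>x. x"]] by simp

text \<open>Because \<open>ddi\<close> preserves \<open>\<rho>\<close>, preimages of null sets are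
  null. Hence almost everywhere equality with \<open>ddi\<close> passes to the second
  iterate.\<close>

lemma AE_rho_ddi:
  assumes "AE x in \<rho>. P x"
  shows "AE x in \<rho>. P (ddi x)"
proof -
  have "AE x in distr \<rho> \<rho> ddi. P x"
    unfolding distr_ddi by (rule assms)
  with measurable_rhoI[OF ddi_measurable ddi_pos] show ?thesis
    by (rule AE_distrD)
qed

text \<open>The orbit depends continuously on its parameter, so each neighbourhood of the point
  contains the orbits over a whole interval around \<open>t\<close>, which has positive
  mass.\<close>

lemma plan_support_ddi:
  assumes T: "T \<in> \<rho> \<rightarrow>\<^sub>M \<rho>" and eq: "AE x in \<rho>. T x = ddi x" and t: "1 < t" "t < 2"
  shows "vector [t, 4 - t, t + 2] \<in> plan_support (cyclic_plan \<rho> T)"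
proof -
  let ?p = "\<lambda>x. vector [x, T x, (T ^^ 2) x] :: real^3" and ?q = "\<lambda>x. vector [x, 4 - x, x + 2] :: real^3"
  have T2: "(\<lambda>x. (T ^^ 2) x) \<in> \<rho> \<rightarrow>\<^sub>M \<rho>"
    using measurable_compose[OF T T] by (simp add: numeral_2_eq_2)
  have [measurable]: "?p \<in> borel_measurable \<rho>"
    unfolding vector_3_scaleR
    by (intro borel_measurable_add borel_measurable_scaleR borel_measurable_const
        measurable_rho_into_borel[OF T] measurable_rho_into_borel[OF T2]
        measurable_rho_borel[of "\<lambda>x. x"]) simp
  have "0 < emeasure (cyclic_plan \<rho> T) U" if U: "open U" "?q t \<in> U" for U
  proof -
    have "continuous_on UNIV ?q"
      unfolding vector_3_scaleR by (intro continuous_intros)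
    then have "open (?q -` U)"
      using U by (simp add: continuous_on_open_vimage)
    then obtain e where e: "e > 0" "ball t e \<subseteq> ?q -` U"
      using U(2) unfolding open_contains_ball by blast
    \<comment> \<open>The interval is clipped to (1,2), where the orbit of \<open>x\<close> under
      \<open>ddi\<close> is \<open>x\<close>, \<open>4 - x\<close>, \<open>x + 2\<close>.\<close>
    define l u where "l = max 1 (t - e)" and "u = min 2 (t + e)"
    have lu: "1 \<le> l" "l < u" "u \<le> 2"
      using t e by (auto simp: l_def u_def)
    have sub: "?q x \<in> U" if "l < x" "x < u" for x
    proof -
      have "x \<in> ball t e" using that by (auto simp: l_def u_def dist_real_def)
      then show ?thesis using e by auto
    qed
    have "{l<..<u} \<inter> {1<..<4} = {l<..<u}" using lu by auto
    then have "0 < emeasure \<rho> {l<..<u}"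
      using lu by (subst emeasure_rho) (auto simp: ennreal_zero_less_mult_iff)
    also have "\<dots> \<le> emeasure \<rho> (?p -` U \<inter> space \<rho>)"
    proof (rule emeasure_mono_AE)
      show "AE x in \<rho>. x \<in> {l<..<u} \<longrightarrow> x \<in> ?p -` U \<inter> space \<rho>"
        using eq AE_rho_ddi[OF eq]
      proof eventually_elim
        fix x assume x: "T x = ddi x" "T (ddi x) = ddi (ddi x)"
        show "x \<in> {l<..<u} \<longrightarrow> x \<in> ?p -` U \<inter> space \<rho>"
        proof
          assume "x \<in> {l<..<u}"
          moreover from this have "?p x = ?q x"
            using lu x by (simp add: numeral_2_eq_2 ddi_def add.commute)
          ultimately show "x \<in> ?p -` U \<inter> space \<rho>"
            using sub lu by auto
        qed
      qed
      show "?p -` U \<inter> space \<rho> \<in> sets \<rho>"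
        using U by (intro measurable_sets[where A = borel]) auto
    qed
    also have "\<dots> = emeasure (cyclic_plan \<rho> T) U"
      using U unfolding cyclic_plan_def by (subst emeasure_distr) auto
    finally show ?thesis .
  qed
  then show ?thesis
    using t by (simp add: plan_support_def forall_3)
qed

lemma not_c_monotone_ddi:
  assumes T: "T \<in> \<rho> \<rightarrow>\<^sub>M \<rho>" and eq: "AE x in \<rho>. T x = ddi x"
  shows "\<not> c_monotone (plan_support (cyclic_plan \<rho> T))"
proof
  assume cm: "c_monotone (plan_support (cyclic_plan \<rho> T))"
  \<comment> \<open>Orbit parameters inside the two end windows: the limits 1 and 2 are outside the
    range of \<open>plan_support_ddi\<close>. The choice \<open>{1, 2}\<close> of swapped indices
    exchanges the largest radii.\<close>
  let ?x = "vector [1.0005, 4 - 1.0005, 1.0005 + 2] :: real^3"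
    and ?y = "vector [1.9995, 4 - 1.9995, 1.9995 + 2] :: real^3"
  have "?x \<in> plan_support (cyclic_plan \<rho> T)" "?y \<in> plan_support (cyclic_plan \<rho> T)"
    by (rule plan_support_ddi[OF T eq]; simp)+
  with cm have "cost_vec ?x + cost_vec ?y \<le> cost_vec (swap_X ?x ?y {1, 2}) + cost_vec (swap_Y ?x ?y {1, 2})"
    by (auto simp: c_monotone_def)
  also have "\<dots> = cost 1.0005 (4 - 1.0005) (1.9995 + 2) + cost 1.9995 (4 - 1.9995) (1.0005 + 2)"
    by (simp add: cost_vec_def swap_X_def swap_Y_def)
  also have "\<dots> \<le> ennreal 0.6584 + ennreal 0.7464"
    by (intro add_mono cost_le_1_3_4 cost_le_2_2_3) simp_all
  also have "\<dots> = ennreal (0.6584 + 0.7464)"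
    by (rule ennreal_plus[symmetric]) simp_all
  also have "\<dots> < ennreal (0.7469 + 0.6618)"
    by (intro ennreal_lessI) simp_all
  also have "\<dots> = ennreal 0.7469 + ennreal 0.6618"
    by (rule ennreal_plus) simp_all
  also have "\<dots> \<le> cost 1.0005 (4 - 1.0005) (1.0005 + 2) + cost 1.9995 (4 - 1.9995) (1.9995 + 2)"
    by (intro add_mono cost_ge_1_3_3 cost_ge_2_2_4) simp_all
  also have "\<dots> = cost_vec ?x + cost_vec ?y"
    by (simp add: cost_vec_def)
  finally show False by simp
qed

section \<open>Failure of optimality\<close>

lemma monge_cost_cong:
  assumes eq: "AE x in \<rho>. T x = ddi x"
  shows "monge_cost \<rho> T = monge_cost \<rho> ddi"
  unfolding monge_cost_def using eq AE_rho_ddi[OF eq]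
  by (intro nn_integral_cong_AE, eventually_elim) (simp add: numeral_2_eq_2)

text \<open>Conjugation by a measure-preserving involution keeps both the invariance of
  \<open>\<rho>\<close> and the order three.\<close>

lemma exch_conjugate_admissible: "exch \<circ> ddi \<circ> exch \<in> cyclic_admissible \<rho>"
proof -
  have m: "ddi \<in> \<rho> \<rightarrow>\<^sub>M \<rho>" "exch \<in> \<rho> \<rightarrow>\<^sub>M \<rho>"
    by (rule measurable_rhoI; simp add: ddi_pos exch_pos)+
  have "distr \<rho> \<rho> (exch \<circ> ddi \<circ> exch) = distr (distr (distr \<rho> \<rho> exch) \<rho> ddi) \<rho> exch"
    using m by (simp add: distr_distr comp_assoc)
  then have "distr \<rho> \<rho> (exch \<circ> ddi \<circ> exch) = \<rho>"
    by (simp add: distr_exch distr_ddi)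
  moreover have "exch \<circ> ddi \<circ> exch \<in> \<rho> \<rightarrow>\<^sub>M \<rho>"
    using m by (intro measurable_comp)
  ultimately show ?thesis
    by (simp add: cyclic_admissible_def numeral_3_eq_3)
qed

theorem mainTheorem1:
  shows "\<exists>\<epsilon>::real. \<epsilon> > 0 \<and> prob_space (rho_eps \<epsilon>) \<and>
           (\<exists>T. DDI_map (rho_eps \<epsilon>) T) \<and>
           (\<forall>T. DDI_map (rho_eps \<epsilon>) T \<longrightarrow>
                  \<not> c_monotone (plan_support (cyclic_plan (rho_eps \<epsilon>) T)) \<and>
                  \<not> monge_optimal (rho_eps \<epsilon>) T)"
proof (intro exI[of _ "1 / 4"] conjI allI impI)
  show "\<exists>T. DDI_map \<rho> T" using DDI_map_ddi by blast
next
  fix T assume ddi: "DDI_map \<rho> T"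
  then have T: "T \<in> \<rho> \<rightarrow>\<^sub>M \<rho>" and eq: "AE x in \<rho>. T x = ddi x"
    by (simp_all add: DDI_map_def DDI_map_unique)
  show "\<not> c_monotone (plan_support (cyclic_plan \<rho> T))"
    by (rule not_c_monotone_ddi[OF T eq])
  have "(INF S\<in>cyclic_admissible \<rho>. monge_cost \<rho> S) < monge_cost \<rho> T"
    using INF_lower[OF exch_conjugate_admissible] exch_improves
    unfolding monge_cost_cong[OF eq] by (rule order_le_less_trans)
  then show "\<not> monge_optimal \<rho> T"
    by (auto simp: monge_optimal_def)
qed (simp_all add: prob_space_rho)

end
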